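(* Let $D$ and $\widehat D$ be the diagonal $m\times m$ matrices $$D=\operatorname{diag}\{d_1,\dots,d_m\},\ d_1>d_2>\dots>d_m>0,\qquad \widehat D=\operatorname{diag}\{\widehat d_1,\dots,\widehat d_m\},\ \widehat d_1>\widehat d_2>\dots>\widehat d_m>0,$$ and consider the nonlinear optics ($N$-wave) equation $$[D,\varrho_t]-[\widehat D,\varrho_x]=[D,\varrho][\widehat D,\varrho]-[\widehat D,\varrho][D,\varrho],\qquad \varrho=\varrho^*,$$ on the semi-strip $\mathcal{D}=\{(x,t):0\le x<\infty,\ 0\le t<a\}$, with the initial condition $\varrho(x,0)=\rho(x)$, where $\sup_{x\in[0,\infty)}\|\rho(x)\|<\infty$. Let $\varphi_0(z)$ be the Weyl function of the system $y_x=(\mathrm{i}zD-[D,\rho(x)])y$, $x\ge0$. Suppose that the initial values $\varrho(x,0)=\rho(x)$ are such that, for some $M>0$, $\varphi_0$ is bounded in $\{z:\Im(z)<-M\}$ and $$\int_{-\infty}^{\infty}\bigl(\varphi_0(z)-I_m\bigr)^*\bigl(\varphi_0(z)-I_m\bigr)\,d\xi<\infty,\qquad z=\xi+\mathrm{i}\eta,\quad \eta<-M.$$ Then there is no more than one uniformly bounded and continuously differentiable on $\mathcal{D}$ solution $\varrho=\varrho^*$ of the nonlinear optics equation having these initial values; that is, there is no more than one solution of the corresponding initial value problem.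
   Context: Notation: $[A,B]=AB-BA$; $A^*$ is the conjugate transpose; $I_m$ is the $m\times m$ identity matrix; $\varrho(x,t)$ is an $m\times m$ matrix function; derivatives on the boundary of $\mathcal{D}$ are one-sided; continuously differentiable means differentiable with continuous first derivatives. Weyl function: for $\zeta(x)=-\zeta(x)^*$ bounded on $[0,\infty)$, let $w(x,z)$ be the normalized fundamental solution of $w_x=(\mathrm{i}zD-\zeta(x))w$, $w(0,z)=I_m$. A Weyl function of the system $y_x=(\mathrm{i}zD-\zeta)y$ is an analytic $m\times m$ matrix function $\varphi(z)$ such that, for certain $M>0$ and $r>0$ and for all $z$ in the half-plane $\{z:\Im(z)<-M\}$, $$\int_0^\infty \exp\{\mathrm{i}\overline z xD\}\varphi(z)^*w(x,z)^*w(x,z)\varphi(z)\exp\{-(\mathrm{i}zD+rI_m)x\}\,dx<\infty,$$ and whose entries satisfy the normalization conditions $\varphi_{ij}(z)\equiv1$ for $i=j$ and $\varphi_{ij}(z)\equiv0$ for $i>j$. When $\zeta$ is bounded on $[0,\infty)$, the Weyl function exists and is unique. Here it is applied with $\zeta=[D,\rho]$, where $\rho=\rho^*$.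
   Formalization: Uniqueness is proved for the off-diagonal entries of the solution (equivalently for [D,ϱ]): the equation does not constrain the diagonal, so literal uniqueness fails, e.g. ϱ=0 and ϱ=tI both solve it with zero initial values. *)

theory Defs
  imports "HOL-Complex_Analysis.Complex_Analysis"
begin

text \<open>
  The \<open>m \<times> m\<close> matrices are indexed by a finite linearly ordered type \<open>'m\<close>, whose order plays the
  role of the order of the indices \<open>1 < \<dots> < m\<close>.
\<close>

type_synonym 'm cmat = "complex ^ 'm ^ 'm"

definition diag_mat :: "('m \<Rightarrow> real) \<Rightarrow> 'm::finite cmat" where
  "diag_mat d = (\<chi> i j. if i = j then complex_of_real (d i) else 0)"

definition cscale :: "complex \<Rightarrow> 'm::finite cmat \<Rightarrow> 'm cmat" where
  "cscale c A = map_matrix ((*) c) A"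

definition ctranspose :: "'m::finite cmat \<Rightarrow> 'm cmat" where
  "ctranspose A = (\<chi> i j. cnj (A $ j $ i))"

definition commutator :: "'m::finite cmat \<Rightarrow> 'm cmat \<Rightarrow> 'm cmat" where
  "commutator A B = A ** B - B ** A"

definition mat_exp :: "'m::finite cmat \<Rightarrow> 'm cmat" where
  "mat_exp A = (\<Sum>n. (1 / fact n) *\<^sub>R ((((**) A) ^^ n) (mat 1)))"

definition lower_half_plane :: "real \<Rightarrow> complex set" where
  "lower_half_plane M = {z. Im z < - M}"

text \<open>
  The fundamental solution is taken in the classical sense, with a one-sided derivative at \<open>x = 0\<close>.
  This is the appropriate notion for continuous \<open>\<zeta>\<close>, and the initial value of a continuously
  differentiable solution of the nonlinear optics equation always yields such a \<open>\<zeta>\<close>.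
\<close>

definition fundamental_solution ::
  "'m::finite cmat \<Rightarrow> (real \<Rightarrow> 'm cmat) \<Rightarrow> complex \<Rightarrow> (real \<Rightarrow> 'm cmat) \<Rightarrow> bool" where
  "fundamental_solution D \<zeta> z w \<longleftrightarrow>
     w 0 = mat 1 \<and>
     (\<forall>x\<ge>0. (w has_vector_derivative ((cscale (\<i> * z) D - \<zeta> x) ** w x)) (at x within {0..}))"

text \<open>
  In the inequality defining Weyl functions the integrand is a positive semidefinite matrix, so
  finiteness of the integral amounts to integrability. The values of \<open>\<phi>\<close> outside the half-plane
  are irrelevant.
\<close>

definition weyl_function ::
  "'m::{finite,linorder} cmat \<Rightarrow> (real \<Rightarrow> 'm cmat) \<Rightarrow> (complex \<Rightarrow> 'm cmat) \<Rightarrow> bool" where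
  "weyl_function D \<zeta> \<phi> \<longleftrightarrow>
     (\<exists>w. (\<forall>z. fundamental_solution D \<zeta> z (\<lambda>x. w x z)) \<and>
       (\<exists>M>0. \<exists>r>0.
         (\<forall>i j. (\<lambda>z. \<phi> z $ i $ j) analytic_on lower_half_plane M) \<and>
         (\<forall>z\<in>lower_half_plane M.
            set_integrable lborel {0..} (\<lambda>x::real.
              mat_exp (cscale (\<i> * cnj z * of_real x) D)
              ** ctranspose (\<phi> z) ** ctranspose (w x z) ** w x z ** \<phi> z
              ** mat_exp (- (x *\<^sub>R (cscale (\<i> * z) D + r *\<^sub>R mat 1)))) \<and>
            (\<forall>i. \<phi> z $ i $ i = 1) \<and>
            (\<forall>i j. i > j \<longrightarrow> \<phi> z $ i $ j = 0))))"

definition semi_strip :: "real \<Rightarrow> (real \<times> real) set" where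
  "semi_strip a = {0..} \<times> {0..<a}"

text \<open>Partial derivatives on the semi-strip, one-sided on its boundary.\<close>

definition deriv_x :: "(real \<Rightarrow> real \<Rightarrow> 'm::finite cmat) \<Rightarrow> real \<Rightarrow> real \<Rightarrow> 'm cmat" where
  "deriv_x \<rho> x t = vector_derivative (\<lambda>s. \<rho> s t) (at x within {0..})"

definition deriv_t :: "real \<Rightarrow> (real \<Rightarrow> real \<Rightarrow> 'm::finite cmat) \<Rightarrow> real \<Rightarrow> real \<Rightarrow> 'm cmat" where
  "deriv_t a \<rho> x t = vector_derivative (\<lambda>s. \<rho> x s) (at t within {0..<a})"

definition C1_on_semi_strip :: "real \<Rightarrow> (real \<Rightarrow> real \<Rightarrow> 'm::finite cmat) \<Rightarrow> bool" where
  "C1_on_semi_strip a \<rho> \<longleftrightarrow>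
     (\<lambda>(x, t). \<rho> x t) differentiable_on semi_strip a \<and>
     continuous_on (semi_strip a) (\<lambda>(x, t). deriv_x \<rho> x t) \<and>
     continuous_on (semi_strip a) (\<lambda>(x, t). deriv_t a \<rho> x t)"

definition nonlinear_optics_solution ::
  "'m::finite cmat \<Rightarrow> 'm cmat \<Rightarrow> real \<Rightarrow> (real \<Rightarrow> real \<Rightarrow> 'm cmat) \<Rightarrow> bool" where
  "nonlinear_optics_solution D D' a \<rho> \<longleftrightarrow>
     (\<forall>(x, t)\<in>semi_strip a.
        ctranspose (\<rho> x t) = \<rho> x t \<and>
        commutator D (deriv_t a \<rho> x t) - commutator D' (deriv_x \<rho> x t) =
          commutator D (\<rho> x t) ** commutator D' (\<rho> x t)
          - commutator D' (\<rho> x t) ** commutator D (\<rho> x t))"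

text \<open>
  A solution of the initial value problem in the class in which uniqueness is claimed.
\<close>

definition bounded_C1_ivp_solution ::
  "'m::finite cmat \<Rightarrow> 'm cmat \<Rightarrow> real \<Rightarrow> (real \<Rightarrow> 'm cmat) \<Rightarrow>
     (real \<Rightarrow> real \<Rightarrow> 'm cmat) \<Rightarrow> bool" where
  "bounded_C1_ivp_solution D D' a \<rho>\<^sub>0 \<rho> \<longleftrightarrow>
     C1_on_semi_strip a \<rho> \<and>
     bounded ((\<lambda>(x, t). \<rho> x t) ` semi_strip a) \<and>
     nonlinear_optics_solution D D' a \<rho> \<and>
     (\<forall>x\<ge>0. \<rho> x 0 = \<rho>\<^sub>0 x)"

text \<open>
  Every commutator with a diagonal matrix has zero diagonal and does not depend on the diagonal of
  the other argument, and the diagonal part of the nonlinear optics equation is the trivial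
  identity \<open>0 = 0\<close>. The diagonal entries of a solution are therefore not governed by the equation at
  all (uniqueness of a solution as a full matrix function holds once its diagonal is prescribed), and
  solutions are identified when they have the same off-diagonal entries. For \<open>D\<close> with distinct
  diagonal entries this says that \<open>[D, \<rho>\<^sub>1] = [D, \<rho>\<^sub>2]\<close>; see \<open>same_solution_iff_commutator\<close>.
\<close>

definition same_solution ::
  "real \<Rightarrow> (real \<Rightarrow> real \<Rightarrow> 'm::finite cmat) \<Rightarrow> (real \<Rightarrow> real \<Rightarrow> 'm cmat) \<Rightarrow> bool" where
  "same_solution a \<rho>\<^sub>1 \<rho>\<^sub>2 \<longleftrightarrow>
     (\<forall>(x, t)\<in>semi_strip a. \<forall>i j. i \<noteq> j \<longrightarrow> \<rho>\<^sub>1 x t $ i $ j = \<rho>\<^sub>2 x t $ i $ j)"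

lemma commutator_diag_mat:
  "commutator (diag_mat d) A $ i $ j = complex_of_real (d i - d j) * A $ i $ j"
  by (simp add: commutator_def diag_mat_def matrix_matrix_mult_def if_distrib if_distribR
      algebra_simps cong: if_cong)

lemma same_solution_iff_commutator:
  assumes "inj d"
  shows "same_solution a \<rho>\<^sub>1 \<rho>\<^sub>2 \<longleftrightarrow>
    (\<forall>(x, t)\<in>semi_strip a.
       commutator (diag_mat d) (\<rho>\<^sub>1 x t) = commutator (diag_mat d) (\<rho>\<^sub>2 x t))"
proof -
  have "(i \<noteq> j \<longrightarrow> A $ i $ j = B $ i $ j) \<longleftrightarrow>
      commutator (diag_mat d) A $ i $ j = commutator (diag_mat d) B $ i $ j" for A B i j
    using injD[OF assms, of i j] by (cases "i = j") (auto simp: commutator_diag_mat)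
  then have "(\<forall>i j. i \<noteq> j \<longrightarrow> A $ i $ j = B $ i $ j) \<longleftrightarrow>
      commutator (diag_mat d) A = commutator (diag_mat d) B" for A B
    unfolding vec_eq_iff by presburger
  then show ?thesis
    by (simp add: same_solution_def)
qed

end

theory Submission
  imports Defs
begin

text \<open>
  Entrywise the equation reads
  \<open>(d\<^sub>i - d\<^sub>j) \<partial>\<^sub>t \<rho>\<^sub>i\<^sub>j - (d'\<^sub>i - d'\<^sub>j) \<partial>\<^sub>x \<rho>\<^sub>i\<^sub>j = \<Sum>\<^sub>k e\<^sub>i\<^sub>k\<^sub>j \<rho>\<^sub>i\<^sub>k \<rho>\<^sub>k\<^sub>j\<close>.
  Since \<open>d\<close> and \<open>d'\<close> are ordered in the same way, the speeds \<open>(d'\<^sub>i - d'\<^sub>j) / (d\<^sub>i - d\<^sub>j)\<close> are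
  nonnegative, so the characteristic through \<open>(x, t)\<close>, followed backwards in time, moves to the
  right and reaches the initial line \<open>t = 0\<close> without leaving the semi-strip. The initial values
  therefore determine the bounded solution: integrating along characteristics and iterating shows
  that the difference of two solutions is at most \<open>B (K t)\<^sup>n / n!\<close> for every \<open>n\<close>.
\<close>

text \<open>Chain rule along a characteristic: \<open>deriv_x\<close> and \<open>deriv_t\<close> are
  values of one total derivative, and \<open>0 \<le> c\<close> keeps the path in the semi-strip, its
  boundary included.\<close>

lemma characteristic_derivative:
  fixes \<rho> :: "real \<Rightarrow> real \<Rightarrow> 'm::finite cmat"
  assumes diff: "(\<lambda>(x, t). \<rho> x t) differentiable_on semi_strip a"
    and "0 \<le> x" "0 \<le> c" "t < a" and s: "s \<in> {0..t}"
  shows "((\<lambda>s. \<rho> (x + c * (t - s)) s) has_vector_derivative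
    (deriv_t a \<rho> (x + c * (t - s)) s - c *\<^sub>R deriv_x \<rho> (x + c * (t - s)) s)) (at s within {0..t})"
proof -
  define y where "y = x + c * (t - s)"
  have y: "0 \<le> y" "0 \<le> s" "s < a"
    using assms by (auto simp: y_def)
  then have "(y, s) \<in> semi_strip a"
    by (auto simp: semi_strip_def)
  with diff obtain L where
    L: "((\<lambda>(x, t). \<rho> x t) has_derivative L) (at (y, s) within semi_strip a)"
    unfolding differentiable_on_def differentiable_def by blast
  interpret L: linear L
    using L by (rule has_derivative_linear)
  \<comment> \<open>Restricting the total derivative to the image of a curve treats interior and
    boundary points alike.\<close>
  have L': "((\<lambda>(x, t). \<rho> x t) has_derivative L) (at (p r) within p ` S)"
    if "p r = (y, s)" "p ` S \<subseteq> semi_strip a" for p r and S :: "real set"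
    using has_derivative_subset[OF L that(2)] that(1) by simp
  have chain: "((\<lambda>r. \<rho> (fst (p r)) (snd (p r))) has_vector_derivative L v) (at r within S)"
    if p: "(p has_vector_derivative v) (at r within S)"
      and "p r = (y, s)" "p ` S \<subseteq> semi_strip a" for p v r and S :: "real set"
    using has_derivative_in_compose[OF p[unfolded has_vector_derivative_def] L'[OF that(2,3)]]
    by (simp add: has_vector_derivative_def case_prod_unfold L.scaleR)
  \<comment> \<open>\<open>vector_derivative\<close> is determined only at non-isolated points; a
    connected set with a second point \<open>r'\<close> has no isolated point.\<close>
  have not_bot: "at r within S \<noteq> bot" if "connected S" "r \<in> S" "r' \<in> S" "r \<noteq> r'"
    for r r' and S :: "real set"
    using that connected_imp_perfect[of S r] trivial_limit_within[of r S] by auto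
  have "((\<lambda>r. \<rho> r s) has_vector_derivative L (1, 0)) (at y within {0..})"
    using chain[of "\<lambda>r. (r, s)" "(1, 0)" y "{0..}"] y
    by (force simp: semi_strip_def intro!: derivative_eq_intros)
  moreover have "at y within {0..} \<noteq> bot"
    using y(1) by (intro not_bot[of _ _ "y + 1"]) auto
  ultimately have x: "deriv_x \<rho> y s = L (1, 0)"
    unfolding deriv_x_def by (rule vector_derivative_within[rotated])
  have "((\<lambda>r. \<rho> y r) has_vector_derivative L (0, 1)) (at s within {0..<a})"
    using chain[of "\<lambda>r. (y, r)" "(0, 1)" s "{0..<a}"] y
    by (force simp: semi_strip_def intro!: derivative_eq_intros)
  moreover have "at s within {0..<a} \<noteq> bot"
    using y(2,3) by (intro not_bot[of _ _ "if s = 0 then a / 2 else 0"]) auto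
  ultimately have t: "deriv_t a \<rho> y s = L (0, 1)"
    unfolding deriv_t_def by (rule vector_derivative_within[rotated])
  have "((\<lambda>s. \<rho> (x + c * (t - s)) s) has_vector_derivative L (- c, 1)) (at s within {0..t})"
    using chain[of "\<lambda>r. (x + c * (t - r), r)" "(- c, 1)" s "{0..t}"] assms
    by (force simp: semi_strip_def y_def intro!: derivative_eq_intros)
  also have "(- c, 1) = (0, 1) - c *\<^sub>R (1, 0 :: real)"
    by simp
  finally show ?thesis
    unfolding y_def[symmetric] x t by (simp only: L.diff L.scaleR)
qed

lemma nonlinear_optics_entry:
  assumes "nonlinear_optics_solution (diag_mat d) (diag_mat d') a \<rho>"
    and "(x, t) \<in> semi_strip a"
  shows "(d i - d j) *\<^sub>R (deriv_t a \<rho> x t $ i $ j) - (d' i - d' j) *\<^sub>R (deriv_x \<rho> x t $ i $ j) =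
    (\<Sum>k\<in>UNIV. ((d i - d k) * (d' k - d' j) - (d' i - d' k) * (d k - d j)) *\<^sub>R
      (\<rho> x t $ i $ k * \<rho> x t $ k $ j))"
proof -
  have "(commutator (diag_mat d) (deriv_t a \<rho> x t)
      - commutator (diag_mat d') (deriv_x \<rho> x t)) $ i $ j =
    (commutator (diag_mat d) (\<rho> x t) ** commutator (diag_mat d') (\<rho> x t)
      - commutator (diag_mat d') (\<rho> x t) ** commutator (diag_mat d) (\<rho> x t)) $ i $ j"
    using assms by (fastforce simp only: nonlinear_optics_solution_def)
  then show ?thesis
    by (simp add: commutator_diag_mat matrix_matrix_mult_def scaleR_conv_of_real
        sum_subtractf[symmetric] algebra_simps)
qed

text \<open>Injectivity of \<open>d\<close> permits division by \<open>d i - d j\<close> off the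
  diagonal; nonnegative speeds make backward characteristics end on \<open>t = 0\<close> and never
  on the edge \<open>x = 0\<close>.\<close>

theorem nonlinear_optics_unique:
  fixes d d' :: "'m::finite \<Rightarrow> real"
    and \<rho>\<^sub>1 \<rho>\<^sub>2 :: "real \<Rightarrow> real \<Rightarrow> 'm cmat"
  assumes inj: "inj d"
    and speed: "\<And>i j. 0 \<le> (d' i - d' j) / (d i - d j)"
    and sol: "\<And>\<rho>. \<rho> \<in> {\<rho>\<^sub>1, \<rho>\<^sub>2} \<Longrightarrow> bounded_C1_ivp_solution (diag_mat d) (diag_mat d') a \<rho>\<^sub>0 \<rho>"
  shows "same_solution a \<rho>\<^sub>1 \<rho>\<^sub>2"
proof -
  define e where "e i k j = (d i - d k) * (d' k - d' j) - (d' i - d' k) * (d k - d j)" for i k j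
  define u where "u x t i j = \<rho>\<^sub>1 x t $ i $ j - \<rho>\<^sub>2 x t $ i $ j" for x t i j
  define q where "q \<rho> x t i j =
    (\<Sum>k\<in>UNIV. e i k j *\<^sub>R (\<rho> x t $ i $ k * \<rho> x t $ k $ j))"
    for \<rho> :: "real \<Rightarrow> real \<Rightarrow> 'm cmat" and x t i j
  have "bounded ((\<lambda>(x, t). \<rho>\<^sub>1 x t) ` semi_strip a \<union> (\<lambda>(x, t). \<rho>\<^sub>2 x t) ` semi_strip a)"
    using sol by (simp add: bounded_C1_ivp_solution_def)
  then obtain R where "R > 0" and R: "\<And>\<rho> x t. \<rho> \<in> {\<rho>\<^sub>1, \<rho>\<^sub>2} \<Longrightarrow> (x, t) \<in> semi_strip a \<Longrightarrow>
      norm (\<rho> x t) \<le> R"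
    unfolding bounded_pos by fastforce
  have entry: "norm (\<rho> x t $ i $ j) \<le> R"
    if "\<rho> \<in> {\<rho>\<^sub>1, \<rho>\<^sub>2}" "(x, t) \<in> semi_strip a" for \<rho> :: "real \<Rightarrow> real \<Rightarrow> 'm cmat" and x t i j
    using Finite_Cartesian_Product.norm_nth_le[of "\<rho> x t $ i" j] Finite_Cartesian_Product.norm_nth_le[of "\<rho> x t" i] R[OF that] by linarith
  \<comment> \<open>\<open>\<kappa> (i, j)\<close> is a Lipschitz constant, on the ball of radius
    \<open>R\<close>, of the quadratic source divided by \<open>d i - d j\<close>. For
    \<open>i = j\<close> the division by zero gives 0. The sum \<open>K\<close> serves all pairs at
    once.\<close>
  define \<kappa> where "\<kappa> p = (\<Sum>k\<in>UNIV. \<bar>e (fst p) k (snd p)\<bar>) * (2 * R) / \<bar>d (fst p) - d (snd p)\<bar>"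
    for p
  define K where "K = (\<Sum>p\<in>UNIV. \<kappa> p)"
  have \<kappa>_nonneg: "0 \<le> \<kappa> p" for p
    using \<open>R > 0\<close> by (simp add: \<kappa>_def sum_nonneg)
  have \<kappa>_le: "\<kappa> p \<le> K" for p
    unfolding K_def by (rule member_le_sum) (auto simp: \<kappa>_nonneg)
  have "0 \<le> K"
    using \<kappa>_nonneg \<kappa>_le order_trans by blast

  have q_diff: "norm ((q \<rho>\<^sub>1 x t i j - q \<rho>\<^sub>2 x t i j) /\<^sub>R (d i - d j)) \<le> K * B"
    if st: "(x, t) \<in> semi_strip a" and "i \<noteq> j" and "0 \<le> B"
      and B: "\<And>i j. i \<noteq> j \<Longrightarrow> norm (u x t i j) \<le> B" for x t i j B
  proof -
    have "norm (e i k j *\<^sub>R (\<rho>\<^sub>1 x t $ i $ k * \<rho>\<^sub>1 x t $ k $ j - \<rho>\<^sub>2 x t $ i $ k * \<rho>\<^sub>2 x t $ k $ j))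
        \<le> \<bar>e i k j\<bar> * (2 * R * B)" for k
    proof (cases "k = i \<or> k = j")
      \<comment> \<open>Here \<open>e i k j = 0\<close>, so diagonal entries, over which
        \<open>B\<close> gives no control, drop out of the source.\<close>
      case True
      then show ?thesis
        by (auto simp: e_def)
    next
      case False
      \<comment> \<open>Each summand now has one off-diagonal factor \<open>u\<close>, bounded by
        \<open>B\<close>, and one factor bounded by \<open>R\<close>.\<close>
      have "\<rho>\<^sub>1 x t $ i $ k * \<rho>\<^sub>1 x t $ k $ j - \<rho>\<^sub>2 x t $ i $ k * \<rho>\<^sub>2 x t $ k $ j
          = u x t i k * \<rho>\<^sub>1 x t $ k $ j + \<rho>\<^sub>2 x t $ i $ k * u x t k j"
        by (simp add: u_def algebra_simps)
      also have "norm \<dots> \<le> B * R + R * B"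
        using False \<open>R > 0\<close> \<open>0 \<le> B\<close>
        by (intro norm_triangle_le add_mono)
          (auto simp: norm_mult intro!: mult_mono B entry st)
      also have "B * R + R * B = 2 * R * B"
        by simp
      finally show ?thesis
        unfolding norm_scaleR by (rule mult_left_mono) simp
    qed
    then have "norm (q \<rho>\<^sub>1 x t i j - q \<rho>\<^sub>2 x t i j) \<le> (\<Sum>k\<in>UNIV. \<bar>e i k j\<bar> * (2 * R * B))"
      unfolding q_def sum_subtractf[symmetric] scaleR_diff_right[symmetric]
      by (intro sum_norm_le)
    then have "norm ((q \<rho>\<^sub>1 x t i j - q \<rho>\<^sub>2 x t i j) /\<^sub>R (d i - d j)) \<le> \<kappa> (i, j) * B"
      using injD[OF inj, of i j] \<open>i \<noteq> j\<close>
      by (simp add: \<kappa>_def sum_distrib_left divide_simps mult_ac)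
    also have "\<dots> \<le> K * B"
      using \<kappa>_le \<open>0 \<le> B\<close> by (rule mult_right_mono)
    finally show ?thesis .
  qed

  have bound: "norm (u x t i j) \<le> 2 * R * (K * t) ^ n / fact n"
    if "0 \<le> x" "0 \<le> t" "t < a" "i \<noteq> j" for x t i j n
    using that
  proof (induction n arbitrary: x t i j)
    \<comment> \<open>The induction varies \<open>x\<close>, \<open>t\<close>, \<open>i\<close> and
      \<open>j\<close>, since characteristics change the point and the source couples the entries.
      The start is the crude bound \<open>2 * R\<close>.\<close>
    case 0
    then have "(x, t) \<in> semi_strip a"
      by (simp add: semi_strip_def)
    with entry[of \<rho>\<^sub>1 x t i j] entry[of \<rho>\<^sub>2 x t i j] show ?case
      unfolding u_def using norm_triangle_ineq4[of "\<rho>\<^sub>1 x t $ i $ j" "\<rho>\<^sub>2 x t $ i $ j"] by simp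
  next
    case (Suc n)
    have init: "u x 0 i j = 0" if "0 \<le> x" for x
      using sol[of \<rho>\<^sub>1] sol[of \<rho>\<^sub>2] that by (simp add: bounded_C1_ivp_solution_def u_def)
    show ?case
    proof (cases "t = 0")
      case True
      then show ?thesis
        using init \<open>0 \<le> x\<close> by simp
    next
      case False
      with Suc.prems have "0 < t"
        by simp
      define c where "c = (d' i - d' j) / (d i - d j)"
      have "0 \<le> c"
        unfolding c_def by (rule speed)
      \<comment> \<open>The backward characteristic of the entry \<open>(i, j)\<close>:
        \<open>y t = x\<close>, and \<open>y 0\<close> lies on the initial line.\<close>
      define y where "y s = x + c * (t - s)" for s
      have dij: "d i - d j \<noteq> 0"
        using injD[OF inj, of i j] \<open>i \<noteq> j\<close> by auto
      have st: "(y s, s) \<in> semi_strip a" "0 \<le> y s" if "s \<in> {0..t}" for s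
        using that Suc.prems \<open>0 \<le> c\<close> by (auto simp: semi_strip_def y_def)
      have deriv: "((\<lambda>s. \<rho> (y s) s $ i $ j) has_vector_derivative
          q \<rho> (y s) s i j /\<^sub>R (d i - d j)) (at s within {0..t})"
        if \<rho>: "\<rho> \<in> {\<rho>\<^sub>1, \<rho>\<^sub>2}" and s: "s \<in> {0..t}" for \<rho> :: "real \<Rightarrow> real \<Rightarrow> 'm cmat" and s
      proof -
        note \<rho>_sol = sol[OF \<rho>, unfolded bounded_C1_ivp_solution_def C1_on_semi_strip_def]
        have "((\<lambda>s. \<rho> (y s) s) has_vector_derivative
            (deriv_t a \<rho> (y s) s - c *\<^sub>R deriv_x \<rho> (y s) s)) (at s within {0..t})"
          unfolding y_def
          using \<rho>_sol Suc.prems \<open>0 \<le> c\<close> s by (intro characteristic_derivative) auto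
        then have "((\<lambda>s. \<rho> (y s) s $ i $ j) has_vector_derivative
            (deriv_t a \<rho> (y s) s - c *\<^sub>R deriv_x \<rho> (y s) s) $ i $ j) (at s within {0..t})"
          by (intro bounded_linear.has_vector_derivative[OF bounded_linear_vec_nth])
        \<comment> \<open>Division by \<open>d i - d j\<close> makes the left side of the equation
          the derivative along the characteristic.\<close>
        also have "(deriv_t a \<rho> (y s) s - c *\<^sub>R deriv_x \<rho> (y s) s) $ i $ j =
            ((d i - d j) *\<^sub>R (deriv_t a \<rho> (y s) s $ i $ j)
              - (d' i - d' j) *\<^sub>R (deriv_x \<rho> (y s) s $ i $ j)) /\<^sub>R (d i - d j)"
          using dij by (simp add: c_def scaleR_diff_right divide_inverse_commute)
        also have "\<dots> = q \<rho> (y s) s i j /\<^sub>R (d i - d j)"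
          using \<rho>_sol st[OF s] by (subst nonlinear_optics_entry) (auto simp: q_def e_def)
        finally show ?thesis .
      qed
      have u_deriv: "((\<lambda>s. u (y s) s i j) has_vector_derivative
          (q \<rho>\<^sub>1 (y s) s i j - q \<rho>\<^sub>2 (y s) s i j) /\<^sub>R (d i - d j)) (at s within {0..t})"
        if "s \<in> {0..t}" for s
        unfolding u_def scaleR_diff_right using that
        by (intro has_vector_derivative_diff deriv) auto
      \<comment> \<open>The comparison function is chosen so that its derivative is \<open>K\<close>
        times the bound of stage \<open>n\<close>, which is what \<open>q_diff\<close> yields from
        the induction hypothesis.\<close>
      have "norm (u (y t) t i j - u (y 0) 0 i j) \<le>
          2 * R * (K * t) ^ Suc n / fact (Suc n) - 2 * R * (K * 0) ^ Suc n / fact (Suc n)"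
      proof (rule differentiable_bound_general[OF \<open>0 < t\<close>])
        show "continuous_on {0..t} (\<lambda>s. u (y s) s i j)"
          using u_deriv has_vector_derivative_continuous
          unfolding continuous_on_eq_continuous_within by blast
        show "continuous_on {0..t} (\<lambda>s. 2 * R * (K * s) ^ Suc n / fact (Suc n))"
          by (intro continuous_intros) auto
        fix s
        assume s: "0 < s" "s < t"
        then show "((\<lambda>s. u (y s) s i j) has_vector_derivative
            (q \<rho>\<^sub>1 (y s) s i j - q \<rho>\<^sub>2 (y s) s i j) /\<^sub>R (d i - d j)) (at s)"
          using u_deriv[of s] by (simp add: at_within_Icc_at)
        show "((\<lambda>s. 2 * R * (K * s) ^ Suc n / fact (Suc n)) has_vector_derivative
            K * (2 * R * (K * s) ^ n / fact n)) (at s)"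
          unfolding has_real_derivative_iff_has_vector_derivative[symmetric]
          by (rule derivative_eq_intros refl | simp)+
        show "norm ((q \<rho>\<^sub>1 (y s) s i j - q \<rho>\<^sub>2 (y s) s i j) /\<^sub>R (d i - d j)) \<le>
            K * (2 * R * (K * s) ^ n / fact n)"
          using s st[of s] Suc.prems \<open>R > 0\<close> \<open>0 \<le> K\<close> by (intro q_diff Suc.IH) auto
      qed
      moreover have "y t = x"
        by (simp add: y_def)
      ultimately show ?thesis
        using init[of "y 0"] st(2)[of 0] Suc.prems by simp
    qed
  qed
  \<comment> \<open>These are \<open>2 * R\<close> times the terms of the convergent exponential
    series at \<open>K * t\<close>.\<close>
  have lim: "(\<lambda>n. 2 * R * (K * t) ^ n / fact n) \<longlonglongrightarrow> 0" for t
    using tendsto_mult_right_zero[OF summable_LIMSEQ_zero[OF summable_exp[of "K * t"]], of "2 * R"]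
    by (simp add: field_simps)
  have "norm (u x t i j) \<le> 0" if "0 \<le> x" "0 \<le> t" "t < a" "i \<noteq> j" for x t i j
    by (rule LIMSEQ_le_const[OF lim]) (use bound[OF that] in blast)
  then show ?thesis
    by (auto simp: same_solution_def semi_strip_def u_def)
qed

theorem theorem4p2:
  fixes d d' :: "'m::{finite,linorder} \<Rightarrow> real"
    and D D' :: "'m cmat"
    and a M :: real
    and \<rho>\<^sub>0 :: "real \<Rightarrow> 'm cmat"
    and \<phi>\<^sub>0 :: "complex \<Rightarrow> 'm cmat"
    and \<rho>\<^sub>1 \<rho>\<^sub>2 :: "real \<Rightarrow> real \<Rightarrow> 'm cmat"
  assumes "\<And>i j. i < j \<Longrightarrow> d i > d j" and "\<And>i. d i > 0"
    and "\<And>i j. i < j \<Longrightarrow> d' i > d' j" and "\<And>i. d' i > 0"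
    and "D = diag_mat d" and "D' = diag_mat d'"
    and "a > 0"
    and "\<And>x. x \<ge> 0 \<Longrightarrow> ctranspose (\<rho>\<^sub>0 x) = \<rho>\<^sub>0 x"
    and "bounded (\<rho>\<^sub>0 ` {0..})"
    and "weyl_function D (\<lambda>x. commutator D (\<rho>\<^sub>0 x)) \<phi>\<^sub>0"
    and "M > 0"
    and "bounded (\<phi>\<^sub>0 ` lower_half_plane M)"
    and "\<And>\<eta>. \<eta> < - M \<Longrightarrow>
           integrable lborel (\<lambda>\<xi>::real.
             ctranspose (\<phi>\<^sub>0 (Complex \<xi> \<eta>) - mat 1) ** (\<phi>\<^sub>0 (Complex \<xi> \<eta>) - mat 1))"
    and "bounded_C1_ivp_solution D D' a \<rho>\<^sub>0 \<rho>\<^sub>1"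
    and "bounded_C1_ivp_solution D D' a \<rho>\<^sub>0 \<rho>\<^sub>2"
  shows "same_solution a \<rho>\<^sub>1 \<rho>\<^sub>2"
proof (rule nonlinear_optics_unique)
  show "inj d"
    by (rule injI) (metis assms(1) less_irrefl linorder_less_linear)
  \<comment> \<open>Off the diagonal both differences have the same sign; for \<open>i = j\<close>
    the quotient \<open>0 / 0\<close> is 0 by convention.\<close>
  show "0 \<le> (d' i - d' j) / (d i - d j)" for i j
    using assms(1)[of i j] assms(1)[of j i] assms(3)[of i j] assms(3)[of j i]
    by (cases i j rule: linorder_cases) (auto intro: divide_nonneg_nonneg divide_nonpos_nonpos)
  show "bounded_C1_ivp_solution (diag_mat d) (diag_mat d') a \<rho>\<^sub>0 \<rho>" if "\<rho> \<in> {\<rho>\<^sub>1, \<rho>\<^sub>2}" for \<rho>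
    using assms that by blast
qed

end
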